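(* For every even $d\ge 2$ and every integer $n>(d-1)\left(\sqrt{2d}+2\sqrt{2\sqrt{2d}}+5\right)$, there exists a simple $d$-polytope with $n$ vertices.
   Context: A $d$-polytope is a $d$-dimensional convex polytope; it is simple if every vertex lies in exactly $d$ facets. *)

theory Defs
  imports "HOL-Analysis.Analysis"
begin

definition d_polytope :: "nat \<Rightarrow> 'a::euclidean_space set \<Rightarrow> bool" where
  "d_polytope d P \<longleftrightarrow> polytope P \<and> aff_dim P = int d"

definition vertices :: "'a::euclidean_space set \<Rightarrow> 'a set" where
  "vertices P = {v. v extreme_point_of P}"

definition simple_polytope :: "nat \<Rightarrow> 'a::euclidean_space set \<Rightarrow> bool" where
  "simple_polytope d P \<longleftrightarrow>
     d_polytope d P \<and> (\<forall>v \<in> vertices P. card {F. F facet_of P \<and> v \<in> F} = d)"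

end

theory Submission
  imports Defs
begin

text \<open>
  Truncating a simple \<open>d\<close>-polytope at a face that is a \<open>k\<close>-simplex (with \<open>k \<le> d - 2\<close>) replaces the
  \<open>k + 1\<close> vertices of the face by \<open>(k + 1) (d - k)\<close> new ones and yields a simple polytope that again
  has a \<open>k\<close>-simplex face, hence simplex faces of all smaller dimensions. Starting from the simplex,
  truncations of non-increasing dimensions \<open>k\<^sub>1, k\<^sub>2, \<dots>\<close> therefore produce
  \<open>d + 1 + (d - 1) \<Sum>(k\<^sub>i + 1) - \<Sum>k\<^sub>i (k\<^sub>i + 1)\<close> vertices. As \<open>d - 1\<close> is odd, some \<open>T < d - 1\<close> makes
  \<open>n - (d + 1) + 2 T\<close> a multiple \<open>(d - 1) K\<close>, and it remains to write \<open>T\<close> as a sum of triangular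
  numbers \<open>k\<^sub>i (k\<^sub>i + 1) / 2\<close> with \<open>\<Sum>(k\<^sub>i + 1) \<le> K\<close> (zeros fill up the difference). The greedy
  decomposition is cheap enough: \<open>k\<^sub>1 \<le> \<surd>(2 d)\<close>, and the remainder after the first term is at most \<open>k\<^sub>1\<close>.

  Polytopes are handled through inequalities \<open>a i \<bullet> x \<le> b i\<close> whose normals are linearly independent
  whenever they are active simultaneously; then a vertex is the same as a \<open>d\<close>-element active set, and
  truncation acts on the family of these sets in a purely combinatorial way.
\<close>

section \<open>Simple systems of linear inequalities\<close>

definition halfspace_region :: "(nat \<Rightarrow> 'a::euclidean_space) \<Rightarrow> (nat \<Rightarrow> real) \<Rightarrow> nat set \<Rightarrow> 'a set" where
  "halfspace_region a b I = {x. \<forall>i\<in>I. a i \<bullet> x \<le> b i}"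

definition active :: "(nat \<Rightarrow> 'a::euclidean_space) \<Rightarrow> (nat \<Rightarrow> real) \<Rightarrow> nat set \<Rightarrow> 'a \<Rightarrow> nat set" where
  "active a b I x = {i\<in>I. a i \<bullet> x = b i}"

text \<open>
  A dual family expresses linear independence of the \<^emph>\<open>indexed\<close> family \<open>a\<close> on \<open>A\<close>; the dual vectors serve
  as edge directions.
\<close>
definition has_dual_family :: "(nat \<Rightarrow> 'a::euclidean_space) \<Rightarrow> nat set \<Rightarrow> bool" where
  "has_dual_family a A \<longleftrightarrow> (\<forall>i\<in>A. \<exists>u. a i \<bullet> u = 1 \<and> (\<forall>j\<in>A - {i}. a j \<bullet> u = 0))"

definition vertex_sets :: "(nat \<Rightarrow> 'a::euclidean_space) \<Rightarrow> (nat \<Rightarrow> real) \<Rightarrow> nat set \<Rightarrow> nat set set" where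
  "vertex_sets a b I =
     {active a b I x | x. x \<in> halfspace_region a b I \<and> card (active a b I x) = DIM('a)}"

section \<open>Linear algebra of dual families\<close>

lemma has_dual_family_inj_on:
  assumes "has_dual_family a A"
  shows "inj_on a A"
proof (rule inj_onI, rule ccontr)
  fix i j assume ij: "i \<in> A" "j \<in> A" "a i = a j" "i \<noteq> j"
  then obtain u where "a i \<bullet> u = 1" "\<forall>k\<in>A - {i}. a k \<bullet> u = 0"
    using assms unfolding has_dual_family_def by blast
  then show False using ij by force
qed

lemma has_dual_family_independent:
  assumes "has_dual_family a A"
  shows "independent (a ` A)"
proof -
  have False if i: "i \<in> A" and s: "a i \<in> span (a ` A - {a i})" for i
  proof -
    obtain u where u: "a i \<bullet> u = 1" "\<forall>k\<in>A - {i}. a k \<bullet> u = 0"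
      using assms i unfolding has_dual_family_def by blast
    have "x \<bullet> u = 0" if "x \<in> span (a ` A - {a i})" for x
      using that
    proof (induction rule: span_induct)
      case base
      then show ?case by (simp add: subspace_def inner_left_distrib)
    next
      case (step x)
      then show ?case using u(2) by auto
    qed
    then show False using s u(1) by fastforce
  qed
  then show ?thesis unfolding dependent_def by blast
qed

lemma has_dual_family_card_le:
  fixes a :: "nat \<Rightarrow> 'a::euclidean_space"
  assumes "has_dual_family a A" "finite A"
  shows "card A \<le> DIM('a)"
  using independent_card_le[OF has_dual_family_independent[OF assms(1)]]
    card_image[OF has_dual_family_inj_on[OF assms(1)]] by simp

lemma has_dual_family_orthogonal_zero:
  fixes a :: "nat \<Rightarrow> 'a::euclidean_space"
  assumes "has_dual_family a A" "finite A" "card A = DIM('a)" "\<And>i. i \<in> A \<Longrightarrow> a i \<bullet> u = 0"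
  shows "u = 0"
proof -
  have c: "card (a ` A) = DIM('a)"
    using card_image[OF has_dual_family_inj_on[OF assms(1)]] assms(3) by simp
  have "UNIV \<subseteq> span (a ` A)"
    by (rule card_ge_dim_independent)
      (use has_dual_family_independent[OF assms(1)] c in auto)
  then have "u \<in> span (a ` A)" by blast
  moreover have "x \<bullet> u = 0" if "x \<in> span (a ` A)" for x
    using that
  proof (induction rule: span_induct)
    case base
    then show ?case by (simp add: subspace_def inner_left_distrib)
  next
    case (step x)
    then show ?case using assms(4) by auto
  qed
  ultimately show ?thesis by force
qed

lemma exists_orthogonal_if_card_less:
  fixes a :: "nat \<Rightarrow> 'a::euclidean_space"
  assumes "finite A" "card A < DIM('a)"
  shows "\<exists>u. u \<noteq> 0 \<and> (\<forall>i\<in>A. a i \<bullet> u = 0)"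
proof -
  have "dim (a ` A) \<le> card (a ` A)" using assms(1) by (intro dim_le_card') auto
  also have "\<dots> \<le> card A" using assms(1) by (rule card_image_le)
  finally have "dim (a ` A) < DIM('a)" using assms(2) by simp
  then obtain u where "u \<noteq> 0" "\<And>y. y \<in> span (a ` A) \<Longrightarrow> orthogonal u y"
    using orthogonal_to_subspace_exists[of "a ` A"] by blast
  then show ?thesis
    by (metis imageI inner_commute orthogonal_def span_base)
qed

lemma has_dual_family_prescribe:
  assumes "has_dual_family a A" "finite A"
  shows "\<exists>u. \<forall>i\<in>A. a i \<bullet> u = c i"
proof -
  obtain w where w: "\<And>i. i \<in> A \<Longrightarrow> a i \<bullet> w i = 1"
      "\<And>i j. i \<in> A \<Longrightarrow> j \<in> A \<Longrightarrow> j \<noteq> i \<Longrightarrow> a j \<bullet> w i = 0"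
    using assms(1) unfolding has_dual_family_def by (metis Diff_iff singletonD)
  have "a i \<bullet> (\<Sum>j\<in>A. c j *\<^sub>R w j) = c i" if "i \<in> A" for i
  proof -
    have "a i \<bullet> (\<Sum>j\<in>A. c j *\<^sub>R w j) = (\<Sum>j\<in>A. if j = i then c i else 0)"
      unfolding inner_sum_right using w that by (intro sum.cong) auto
    then show ?thesis using that assms(2) by simp
  qed
  then show ?thesis by blast
qed

text \<open>Independence is demanded at every point of the region, not only at vertices. It bounds
  every active set by the dimension, excludes repeated active inequalities and makes the region
  full-dimensional.\<close>

locale simple_system =
  fixes a :: "nat \<Rightarrow> 'a::euclidean_space" and b :: "nat \<Rightarrow> real" and I :: "nat set"
  assumes finite_I: "finite I"
    and bounded_region: "bounded (halfspace_region a b I)"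
    and nonempty_region: "halfspace_region a b I \<noteq> {}"
    and dual_active: "x \<in> halfspace_region a b I \<Longrightarrow> has_dual_family a (active a b I x)"
begin

abbreviation "P \<equiv> halfspace_region a b I"
abbreviation "act \<equiv> active a b I"

section \<open>Rays, vertices and extreme points of a simple system\<close>

lemma finite_act: "finite (act x)"
  using finite_I by (simp add: active_def)

text \<open>The ratio test: boundedness forces some inequality to block the ray, and
  \<open>t\<close> is the first blocking time. Strictly before it no inequality becomes active anew,
  so only those with \<open>a i \<bullet> u = 0\<close> remain tight.\<close>

lemma ray_leaves:
  assumes x: "x \<in> P" and u: "u \<noteq> 0" and feas: "\<And>i. i \<in> act x \<Longrightarrow> a i \<bullet> u \<le> 0"
  obtains t k where "t > 0" "x + t *\<^sub>R u \<in> P" "k \<in> act (x + t *\<^sub>R u)" "a k \<bullet> u > 0"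
    "\<forall>s. 0 < s \<and> s < t \<longrightarrow>
       x + s *\<^sub>R u \<in> P \<and> act (x + s *\<^sub>R u) = {i \<in> act x. a i \<bullet> u = 0}"
proof -
  define N where "N = {i\<in>I. a i \<bullet> u > 0}"
  define q where "q i = (b i - a i \<bullet> x) / (a i \<bullet> u)" for i
  have finN: "finite N" using finite_I by (simp add: N_def)
  have le: "a i \<bullet> x \<le> b i" if "i \<in> I" for i using x that by (simp add: halfspace_region_def)
  have "N \<noteq> {}"
  proof
    assume "N = {}"
    then have neg: "a i \<bullet> u \<le> 0" if "i \<in> I" for i using that by (force simp: N_def)
    have "x + s *\<^sub>R u \<in> P" if "s \<ge> 0" for s
      unfolding halfspace_region_def
    proof (safe)
      fix i assume i: "i \<in> I"
      have "s * (a i \<bullet> u) \<le> 0" using neg[OF i] that by (simp add: mult_nonneg_nonpos)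
      then show "a i \<bullet> (x + s *\<^sub>R u) \<le> b i" using le[OF i] by (simp add: inner_right_distrib)
    qed
    moreover obtain B where B: "\<And>y. y \<in> P \<Longrightarrow> norm y \<le> B"
      using bounded_region bounded_iff by metis
    ultimately have bd: "norm (x + s *\<^sub>R u) \<le> B" if "s \<ge> 0" for s using that by blast
    have B0: "B \<ge> 0" using bd[of 0] norm_ge_zero order_trans by blast
    \<comment> \<open>Far enough along the ray that \<open>s *\<^sub>R u\<close> is longer than
      \<open>B + norm x\<close>, which pushes the point out of the ball of radius
      \<open>B\<close>.\<close>
    define s where "s = (B + norm x + 1) / norm u"
    have s0: "s \<ge> 0" using B0 by (simp add: s_def)
    have "norm (s *\<^sub>R u) = B + norm x + 1" using u B0 by (simp add: s_def abs_of_nonneg)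
    moreover have "norm (s *\<^sub>R u) \<le> norm (x + s *\<^sub>R u) + norm x"
      using norm_triangle_ineq4[of "x + s *\<^sub>R u" x] by simp
    ultimately show False using bd[OF s0] by linarith
  qed
  have qpos: "q i > 0" if "i \<in> N" for i
  proof -
    have "i \<notin> act x" using feas that by (force simp: N_def)
    then have "a i \<bullet> x < b i" using le that by (force simp: N_def active_def)
    then show ?thesis using that by (simp add: q_def N_def)
  qed
  define t where "t = Min (q ` N)"
  have t0: "t > 0" using qpos finN \<open>N \<noteq> {}\<close> by (simp add: t_def)
  have tle: "t \<le> q i" if "i \<in> N" for i using that finN by (simp add: t_def)
  have "t \<in> q ` N" unfolding t_def using finN \<open>N \<noteq> {}\<close> by (intro Min_in) auto
  then obtain k where k: "k \<in> N" "t = q k" by blast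
  have kact: "a k \<bullet> (x + t *\<^sub>R u) = b k"
    using k by (simp add: N_def q_def inner_right_distrib)
  have inP: "x + s *\<^sub>R u \<in> P" if s: "0 \<le> s" "s \<le> t" for s
    unfolding halfspace_region_def
  proof safe
    fix i assume i: "i \<in> I"
    show "a i \<bullet> (x + s *\<^sub>R u) \<le> b i"
    proof (cases "i \<in> N")
      case True
      then have "s \<le> q i" "a i \<bullet> u > 0" using tle s by (force simp: N_def)+
      then have "s * (a i \<bullet> u) \<le> b i - a i \<bullet> x" by (simp add: q_def field_simps)
      then show ?thesis by (simp add: inner_right_distrib)
    next
      case False
      then have "s * (a i \<bullet> u) \<le> 0" using i s by (simp add: N_def mult_nonneg_nonpos)
      then show ?thesis using le[OF i] by (simp add: inner_right_distrib)
    qed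
  qed
  have actS: "act (x + s *\<^sub>R u) = {i \<in> act x. a i \<bullet> u = 0}" if s: "0 < s" "s < t" for s
  proof -
    have "a i \<bullet> x = b i \<and> a i \<bullet> u = 0" if i: "i \<in> I" and eq: "a i \<bullet> (x + s *\<^sub>R u) = b i" for i
    proof (cases "i \<in> N")
      case True
      then have "s < q i" "a i \<bullet> u > 0" using tle s by (force simp: N_def)+
      then have "s * (a i \<bullet> u) < b i - a i \<bullet> x" by (simp add: q_def field_simps)
      then show ?thesis using eq by (simp add: inner_right_distrib)
    next
      case False
      then have "a i \<bullet> u \<le> 0" using i by (simp add: N_def)
      then have "s * (a i \<bullet> u) \<le> 0" using s by (simp add: mult_nonneg_nonpos)
      moreover have "a i \<bullet> x + s * (a i \<bullet> u) = b i" using eq by (simp add: inner_right_distrib)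
      ultimately have "s * (a i \<bullet> u) = 0" "a i \<bullet> x = b i"
        using le[OF i] by linarith+
      then show ?thesis using s by simp
    qed
    then show ?thesis by (auto simp: active_def inner_right_distrib)
  qed
  show thesis
  proof (rule that[OF t0])
    show "x + t *\<^sub>R u \<in> P" using inP t0 by simp
    show "k \<in> act (x + t *\<^sub>R u)" "a k \<bullet> u > 0"
      using k(1) kact by (simp_all add: N_def active_def)
    show "\<forall>s. 0 < s \<and> s < t \<longrightarrow>
        x + s *\<^sub>R u \<in> P \<and> act (x + s *\<^sub>R u) = {i \<in> act x. a i \<bullet> u = 0}"
      using inP actS by simp
  qed
qed

text \<open>Take a point with the largest active set above that of \<open>x\<close>. With fewer than
  \<open>DIM('a)\<close> active normals, some direction is orthogonal to all of them, and following
  it until it is blocked would enlarge the set.\<close>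

lemma exists_vertex_above:
  assumes "x \<in> P"
  shows "\<exists>v\<in>P. act x \<subseteq> act v \<and> card (act v) = DIM('a)"
proof -
  define Q where "Q y \<longleftrightarrow> y \<in> P \<and> act x \<subseteq> act y" for y
  have bd: "card (act y) < Suc (card I)" for y
    using finite_I by (simp add: active_def less_Suc_eq_le card_mono)
  have "Q x" using assms by (simp add: Q_def)
  then obtain v where v: "Q v" and mx: "\<And>y. Q y \<Longrightarrow> card (act y) \<le> card (act v)"
    using ex_has_greatest_nat[of Q x "\<lambda>y. card (act y)" "Suc (card I)"] bd less_imp_le by blast
  have vP: "v \<in> P" and sub: "act x \<subseteq> act v" using v by (auto simp: Q_def)
  have "\<not> card (act v) < DIM('a)"
  proof
    assume "card (act v) < DIM('a)"
    then obtain u where u: "u \<noteq> 0" "\<forall>i\<in>act v. a i \<bullet> u = 0"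
      using exists_orthogonal_if_card_less[OF finite_act] by blast
    obtain t k where t: "t > 0" "v + t *\<^sub>R u \<in> P" "k \<in> act (v + t *\<^sub>R u)" "a k \<bullet> u > 0"
      by (rule ray_leaves[OF vP u(1)]) (use u in auto)
    have s1: "act v \<subseteq> act (v + t *\<^sub>R u)" using u by (auto simp: active_def inner_right_distrib)
    have "k \<notin> act v" using u t by auto
    then have "act v \<subset> act (v + t *\<^sub>R u)" using s1 t by blast
    then have "card (act v) < card (act (v + t *\<^sub>R u))" using finite_act by (rule psubset_card_mono[rotated])
    moreover have "Q (v + t *\<^sub>R u)" using t s1 sub by (auto simp: Q_def)
    ultimately show False using mx by force
  qed
  then have "card (act v) = DIM('a)"
    using has_dual_family_card_le[OF dual_active[OF vP] finite_act] by simp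
  then show ?thesis using vP sub by blast
qed

lemma inj_on_act_vertices:
  "inj_on act {x\<in>P. card (act x) = DIM('a)}"
proof (rule inj_onI)
  fix x y assume "x \<in> {x\<in>P. card (act x) = DIM('a)}" "y \<in> {x\<in>P. card (act x) = DIM('a)}"
    and eq: "act x = act y"
  then have x: "x \<in> P" "card (act x) = DIM('a)" by auto
  have "a i \<bullet> (x - y) = 0" if "i \<in> act x" for i
    using that eq that[unfolded eq] by (simp add: active_def inner_diff_right)
  then have "x - y = 0"
    by (rule has_dual_family_orthogonal_zero[OF dual_active[OF x(1)] finite_act x(2)])
  then show "x = y" by simp
qed

lemma vertex_sets_eq_image: "vertex_sets a b I = act ` {x\<in>P. card (act x) = DIM('a)}"
  by (auto simp: vertex_sets_def)

lemma vertex_sets_subset: "vertex_sets a b I \<subseteq> Pow I"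
  by (auto simp: vertex_sets_def active_def)

lemma finite_vertex_sets: "finite (vertex_sets a b I)"
  using vertex_sets_subset finite_I by (meson finite_Pow_iff finite_subset)

lemma finite_vertices: "finite {x\<in>P. card (act x) = DIM('a)}"
  using finite_vertex_sets inj_on_act_vertices vertex_sets_eq_image finite_imageD by metis

lemma small_step:
  assumes "x \<in> P"
  obtains t where "t > 0" "\<And>i. i \<in> I - act x \<Longrightarrow> a i \<bullet> (x + t *\<^sub>R u) < b i"
proof -
  have "\<forall>\<^sub>F t in at_right 0. \<forall>i\<in>I - act x. a i \<bullet> (x + t *\<^sub>R u) < b i"
  proof (rule eventually_ball_finite)
    show "finite (I - act x)" using finite_I by simp
    show "\<forall>i\<in>I - act x. \<forall>\<^sub>F t in at_right 0. a i \<bullet> (x + t *\<^sub>R u) < b i"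
    proof
      fix i assume i: "i \<in> I - act x"
      have "((\<lambda>t. a i \<bullet> (x + t *\<^sub>R u)) \<longlongrightarrow> a i \<bullet> (x + 0 *\<^sub>R u)) (at_right 0)"
        by (intro tendsto_intros)
      moreover have "a i \<bullet> (x + 0 *\<^sub>R u) < b i"
        using i assms by (force simp: active_def halfspace_region_def)
      ultimately show "\<forall>\<^sub>F t in at_right 0. a i \<bullet> (x + t *\<^sub>R u) < b i"
        by (rule order_tendstoD(2))
    qed
  qed
  moreover have "\<forall>\<^sub>F t in at_right (0::real). t > 0" by (simp add: eventually_at_right_less)
  ultimately have "\<forall>\<^sub>F t in at_right 0. t > 0 \<and> (\<forall>i\<in>I - act x. a i \<bullet> (x + t *\<^sub>R u) < b i)"
    by (rule eventually_conj[rotated])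
  then obtain t where "t > 0" "\<forall>i\<in>I - act x. a i \<bullet> (x + t *\<^sub>R u) < b i"
    using eventually_happens by force
  then show thesis using that by blast
qed

text \<open>Too few active normals leave room to move both ways along an orthogonal direction.
  Conversely, inequalities tight inside a segment are tight at both ends, so with
  \<open>DIM('a)\<close> independent ones the ends coincide.\<close>

lemma extreme_point_iff:
  "x extreme_point_of P \<longleftrightarrow> x \<in> P \<and> card (act x) = DIM('a)"
proof
  assume ext: "x extreme_point_of P"
  then have xP: "x \<in> P" by (simp add: extreme_point_of_def)
  have "\<not> card (act x) < DIM('a)"
  proof
    assume "card (act x) < DIM('a)"
    then obtain u where u: "u \<noteq> 0" "\<forall>i\<in>act x. a i \<bullet> u = 0"
      using exists_orthogonal_if_card_less[OF finite_act] by blast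
    have step: "\<exists>t>0. x + t *\<^sub>R w \<in> P" if "w \<in> {u, -u}" for w
    proof -
      have w: "w \<noteq> 0" "\<And>i. i \<in> act x \<Longrightarrow> a i \<bullet> w \<le> 0" using that u by auto
      show ?thesis by (rule ray_leaves[OF xP w]) auto
    qed
    obtain s where s: "s > 0" "x + s *\<^sub>R u \<in> P" using step by blast
    obtain t where t: "t > 0" "x + t *\<^sub>R (- u) \<in> P" using step by blast
    have "x \<in> open_segment (x + t *\<^sub>R (- u)) (x + s *\<^sub>R u)"
      unfolding in_segment
    \<comment> \<open>This weight cancels the coefficient of \<open>u\<close>.\<close>
    proof (intro conjI exI[of _ "t / (s + t)"])
      have "s *\<^sub>R u \<noteq> - (t *\<^sub>R u)"
        using u s t by (metis add_pos_pos eq_neg_iff_add_eq_0 less_irrefl scaleR_eq_0_iff scaleR_left_distrib)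
      then show "x + t *\<^sub>R - u \<noteq> x + s *\<^sub>R u" by auto
      have 1: "1 - t / (s + t) = s / (s + t)" using s t by (simp add: field_simps)
      have 2: "s / (s + t) + t / (s + t) = 1" using s t by (simp flip: add_divide_distrib)
      have "(1 - t / (s + t)) *\<^sub>R (x + t *\<^sub>R - u) + (t / (s + t)) *\<^sub>R (x + s *\<^sub>R u)
        = (s / (s + t) + t / (s + t)) *\<^sub>R x + ((t / (s + t)) * s - s / (s + t) * t) *\<^sub>R u"
        unfolding 1 by (simp only: scaleR_left_distrib scaleR_left_diff_distrib scaleR_right_distrib) simp
      also have "\<dots> = x" unfolding 2 by simp
      finally show "x = (1 - t / (s + t)) *\<^sub>R (x + t *\<^sub>R - u) + (t / (s + t)) *\<^sub>R (x + s *\<^sub>R u)" by simp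
    qed (use s t in auto)
    then show False using ext s t by (auto simp: extreme_point_of_def)
  qed
  then show "x \<in> P \<and> card (act x) = DIM('a)"
    using xP has_dual_family_card_le[OF dual_active[OF xP] finite_act] by simp
next
  assume x: "x \<in> P \<and> card (act x) = DIM('a)"
  have "x \<notin> open_segment y z" if yz: "y \<in> P" "z \<in> P" for y z
  proof
    assume "x \<in> open_segment y z"
    then obtain t where t: "0 < t" "t < 1" "x = (1 - t) *\<^sub>R y + t *\<^sub>R z" and ne: "y \<noteq> z"
      by (auto simp: in_segment)
    have "a i \<bullet> (y - z) = 0" if i: "i \<in> act x" for i
    proof -
      have le: "a i \<bullet> y \<le> b i" "a i \<bullet> z \<le> b i"
        using i yz by (auto simp: active_def halfspace_region_def)
      have "(1 - t) * (b i - a i \<bullet> y) + t * (b i - a i \<bullet> z) = 0"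
        using i t(3) by (simp add: active_def inner_right_distrib algebra_simps)
      moreover have "(1 - t) * (b i - a i \<bullet> y) \<ge> 0" "t * (b i - a i \<bullet> z) \<ge> 0"
        using t le by auto
      ultimately have "(1 - t) * (b i - a i \<bullet> y) = 0" "t * (b i - a i \<bullet> z) = 0" by linarith+
      then show ?thesis using t by (simp add: inner_diff_right)
    qed
    then have "y - z = 0"
      using has_dual_family_orthogonal_zero[OF dual_active finite_act] x by blast
    then show False using ne by simp
  qed
  then show "x extreme_point_of P" using x by (auto simp: extreme_point_of_def)
qed

lemma vertices_eq: "vertices P = {x\<in>P. card (act x) = DIM('a)}"
  by (auto simp: vertices_def extreme_point_iff)

lemma card_vertices: "card (vertices P) = card (vertex_sets a b I)"
  unfolding vertices_eq vertex_sets_eq_image using card_image[OF inj_on_act_vertices] by simp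

section \<open>Dimension, irredundancy and facets of the region\<close>

lemma polytope_region: "polytope P"
proof -
  have "P = \<Inter>((\<lambda>i. {x. a i \<bullet> x \<le> b i}) ` I)" by (auto simp: halfspace_region_def)
  moreover have "polyhedron (\<Inter>((\<lambda>i. {x. a i \<bullet> x \<le> b i}) ` I))"
    using finite_I by (intro polyhedron_Inter) (auto simp: polyhedron_halfspace_le)
  ultimately show ?thesis using bounded_region polytope_eq_bounded_polyhedron by metis
qed

lemma aff_dim_region: "aff_dim P = DIM('a)"
proof -
  obtain x where x: "x \<in> P" using nonempty_region by blast
  \<comment> \<open>A direction that makes all active inequalities strict at once; a short step
    along it reaches an interior point.\<close>
  obtain u where u: "\<forall>i\<in>act x. a i \<bullet> u = -1"
    using has_dual_family_prescribe[OF dual_active[OF x] finite_act, of "\<lambda>_. -1"] by blast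
  obtain t where t: "t > 0" "\<And>i. i \<in> I - act x \<Longrightarrow> a i \<bullet> (x + t *\<^sub>R u) < b i"
    using small_step[OF x] by metis
  define U where "U = (\<Inter>i\<in>I. {y. a i \<bullet> y < b i})"
  have "open U" unfolding U_def using finite_I by (intro open_INT) (auto simp: open_halfspace_lt)
  moreover have "U \<subseteq> P" by (force simp: U_def halfspace_region_def)
  moreover have "a i \<bullet> (x + t *\<^sub>R u) < b i" if i: "i \<in> I" for i
  proof (cases "i \<in> act x")
    case True
    then show ?thesis using u t by (simp add: active_def inner_right_distrib)
  qed (use i t in auto)
  then have "x + t *\<^sub>R u \<in> U" by (simp add: U_def)
  ultimately have "interior P \<noteq> {}" using interior_maximal by blast
  then show ?thesis by (rule aff_dim_nonempty_interior)
qed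

text \<open>Irredundancy of inequality \<open>i\<close>: from a point where it is tight, a short
  step raises it above its bound and lowers every other active one.\<close>

lemma violate_only:
  assumes "i \<in> \<Union>(vertex_sets a b I)"
  shows "\<exists>y. a i \<bullet> y > b i \<and> (\<forall>j\<in>I - {i}. a j \<bullet> y < b j)"
proof -
  obtain x where x: "x \<in> P" "i \<in> act x" using assms by (auto simp: vertex_sets_def)
  obtain u where u: "\<forall>j\<in>act x. a j \<bullet> u = (if j = i then 1 else -1)"
    using has_dual_family_prescribe[OF dual_active[OF x(1)] finite_act, of "\<lambda>j. if j = i then 1 else -1"] ..
  obtain t where t: "t > 0" "\<And>j. j \<in> I - act x \<Longrightarrow> a j \<bullet> (x + t *\<^sub>R u) < b j"
    using small_step[OF x(1)] by metis
  have "a j \<bullet> (x + t *\<^sub>R u) < b j" if "j \<in> I - {i}" for j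
  proof (cases "j \<in> act x")
    case True
    then show ?thesis using u t that by (simp add: active_def inner_right_distrib)
  qed (use that t in auto)
  moreover have "a i \<bullet> (x + t *\<^sub>R u) > b i"
    using x u t by (simp add: active_def inner_right_distrib)
  ultimately show ?thesis by blast
qed

lemma facet_iff:
  assumes all: "\<Union>(vertex_sets a b I) = I"
  shows "F facet_of P \<longleftrightarrow> (\<exists>i\<in>I. F = P \<inter> {x. a i \<bullet> x = b i})"
proof -
  define H where "H i = {x. a i \<bullet> x \<le> b i}" for i
  have viol: "\<exists>y. y \<notin> H i \<and> (\<forall>j\<in>I - {i}. y \<in> H j)" if "i \<in> I" for i
  proof -
    have "i \<in> \<Union>(vertex_sets a b I)" using that all by blast
    then obtain y where "a i \<bullet> y > b i" "\<forall>j\<in>I - {i}. a j \<bullet> y < b j" using violate_only by blast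
    then show ?thesis by (intro exI[of _ y]) (simp add: H_def less_imp_le)
  qed
  have inj: "inj_on H I"
  proof (rule inj_onI, rule ccontr)
    fix i j assume ij: "i \<in> I" "j \<in> I" "H i = H j" "i \<noteq> j"
    then obtain y where "y \<notin> H i" "y \<in> H j" using viol[of i] by blast
    then show False using ij by simp
  qed
  \<comment> \<open>The facet criterion speaks of a set of half-spaces rather than an indexed
    family, so \<open>r\<close> recovers the index of a half-space.\<close>
  define r where "r = inv_into I H"
  have r: "r (H i) = i" if "i \<in> I" for i using inj that by (simp add: r_def)
  have hull: "affine hull P = UNIV"
    using aff_dim_region aff_dim_eq_full by blast
  have Peq: "P = affine hull P \<inter> \<Inter>(H ` I)" unfolding hull by (auto simp: H_def halfspace_region_def)
  have "F facet_of P \<longleftrightarrow> (\<exists>h. h \<in> H ` I \<and> F = P \<inter> {x. a (r h) \<bullet> x = b (r h)})"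
  proof (rule facet_of_polyhedron_explicit[OF _ Peq])
    show "finite (H ` I)" using finite_I by simp
    show "a (r h) \<noteq> 0 \<and> h = {x. a (r h) \<bullet> x \<le> b (r h)}" if h: "h \<in> H ` I" for h
    proof -
      obtain i where i: "i \<in> I" "h = H i" using h by blast
      have "i \<in> \<Union>(vertex_sets a b I)" using i(1) all by blast
      then obtain x where x: "x \<in> P" "i \<in> act x" by (auto simp: vertex_sets_def)
      obtain u where "a i \<bullet> u = 1" using dual_active[OF x(1)] x(2) by (auto simp: has_dual_family_def)
      then have "a i \<noteq> 0" by auto
      then show ?thesis using i r by (simp add: H_def)
    qed
    show "P \<subset> affine hull P \<inter> \<Inter>F'" if F': "F' \<subset> H ` I" for F'
    proof -
      obtain i where i: "i \<in> I" "H i \<notin> F'" using F' by blast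
      then obtain y where y: "y \<notin> H i" "\<forall>j\<in>I - {i}. y \<in> H j" using viol by blast
      have "y \<in> h" if h: "h \<in> F'" for h
      proof -
        obtain j where "j \<in> I" "h = H j" using F' h by blast
        then show ?thesis using y i h by (cases "j = i") auto
      qed
      moreover have "y \<notin> P" using y(1) i by (auto simp: H_def halfspace_region_def)
      moreover have "P \<subseteq> \<Inter>F'" using F' Peq by blast
      ultimately show ?thesis unfolding hull by blast
    qed
  qed
  also have "\<dots> \<longleftrightarrow> (\<exists>i\<in>I. F = P \<inter> {x. a i \<bullet> x = b i})" using r by auto
  finally show ?thesis .
qed

lemma simple_polytope_region:
  assumes all: "\<Union>(vertex_sets a b I) = I"
  shows "simple_polytope DIM('a) P"
proof -
  define G where "G i = P \<inter> {x. a i \<bullet> x = b i}" for i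
  have "card {F. F facet_of P \<and> v \<in> F} = DIM('a)" if "v \<in> vertices P" for v
  proof -
    have v: "v \<in> P" "card (act v) = DIM('a)" using that by (auto simp: vertices_eq)
    have "{F. F facet_of P \<and> v \<in> F} = G ` act v"
      using v(1) facet_iff[OF all] by (auto simp: G_def active_def)
    moreover have "inj_on G (act v)"
    proof (rule inj_onI, rule ccontr)
      fix i j assume ij: "i \<in> act v" "j \<in> act v" "G i = G j" "i \<noteq> j"
      \<comment> \<open>The edge at \<open>v\<close> that relaxes only \<open>i\<close> stays on
        facet \<open>j\<close> and leaves facet \<open>i\<close>, so different active indices give
        different facets.\<close>
      obtain u where u: "\<forall>k\<in>act v. a k \<bullet> u = (if k = i then -1 else 0)"
        using has_dual_family_prescribe[OF dual_active[OF v(1)] finite_act, of "\<lambda>k. if k = i then -1 else 0"] ..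
      have u': "u \<noteq> 0" "\<And>k. k \<in> act v \<Longrightarrow> a k \<bullet> u \<le> 0"
        using u ij by force+
      obtain t where t: "t > 0" "v + t *\<^sub>R u \<in> P"
        by (rule ray_leaves[OF v(1) u'])
      have "a i \<bullet> u = -1" "a j \<bullet> u = 0" using u ij by simp_all
      then have "v + t *\<^sub>R u \<in> G j" "v + t *\<^sub>R u \<notin> G i"
        using t ij(1,2) by (simp_all add: G_def active_def inner_right_distrib)
      then show False using ij by simp
    qed
    ultimately show ?thesis using v card_image by metis
  qed
  then show ?thesis
    using polytope_region aff_dim_region by (simp add: simple_polytope_def d_polytope_def)
qed

end

section \<open>Truncation of faces\<close>

text \<open>
  A face is given by the set \<open>J\<close> of inequalities that are tight on it, and \<open>m\<close> is the index of the
  cutting inequality. The new vertex with active set \<open>insert m (A - {j})\<close> lies on the edge that leaves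
  the vertex \<open>A\<close> of the face by relaxing \<open>j\<close>.
\<close>
definition truncate_sets :: "nat set set \<Rightarrow> nat set \<Rightarrow> nat \<Rightarrow> nat set set" where
  "truncate_sets V J m =
     {A\<in>V. \<not> J \<subseteq> A} \<union> {insert m (A - {j}) | A j. A \<in> V \<and> J \<subseteq> A \<and> j \<in> J}"

context simple_system
begin

text \<open>The cut keeps the vertices off the face and meets each edge leaving the face in one new
  vertex. Conversely, a vertex on the cut has one active old inequality too few and so lies on an
  edge; following this edge with decreasing \<open>s\<close> ends at a vertex of the face.\<close>

lemma truncation:
  assumes JI: "J \<subseteq> I" and J0: "J \<noteq> {}" and m: "m \<notin> I"
    and A0: "A0 \<in> vertex_sets a b I" "J \<subseteq> A0"
  shows "\<exists>a' b'. simple_system (a' :: nat \<Rightarrow> 'a) b' (insert m I) \<and>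
           vertex_sets a' b' (insert m I) = truncate_sets (vertex_sets a b I) J m"
proof -
  have finJ: "finite J" using JI finite_I finite_subset by blast
  define s where "s x = (\<Sum>j\<in>J. b j - a j \<bullet> x)" for x
  define Vt where "Vt = {x\<in>P. card (act x) = DIM('a)}"
  have finVt: "finite Vt" using finite_vertices by (simp add: Vt_def)
  \<comment> \<open>The cut is \<open>s x \<ge> e\<close>, where \<open>s\<close> is the total slack of \<open>J\<close> and \<open>e\<close> is below every positive value of
    \<open>s\<close> at a vertex. As every face contains a vertex, \<open>s\<close> is not constant on a face that meets the cut.\<close>
  define e where "e = Min (insert 1 (s ` {v\<in>Vt. s v > 0})) / 2"
  have e0: "e > 0" using finVt by (simp add: e_def)
  have eV: "e < s v" if "v \<in> Vt" "s v > 0" for v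
  proof -
    have "Min (insert 1 (s ` {v\<in>Vt. s v > 0})) \<le> s v" using finVt that by (intro Min_le) auto
    then show ?thesis using e0 by (simp add: e_def)
  qed
  define c where "c = (\<Sum>j\<in>J. a j)"
  define a' where "a' = a(m := c)"
  define b' where "b' = b(m := (\<Sum>j\<in>J. b j) - e)"
  let ?I = "insert m I"
  let ?P = "halfspace_region a' b' ?I"
  let ?act = "active a' b' ?I"
  have s_eq: "s x = (\<Sum>j\<in>J. b j) - c \<bullet> x" for x
    by (simp add: s_def c_def sum_subtractf inner_sum_left)
  have s_line: "s (x + t *\<^sub>R u) = s x - t * (c \<bullet> u)" for x t u
    by (simp add: s_eq inner_right_distrib)
  have same: "a' i = a i" "b' i = b i" if "i \<in> I" for i using m that by (auto simp: a'_def b'_def)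
  have P': "?P = {x\<in>P. s x \<ge> e}"
    using same by (auto simp: halfspace_region_def a'_def b'_def s_eq)
  have act': "?act x = (if s x = e then insert m (act x) else act x)" for x
    using same m by (auto simp: active_def a'_def b'_def s_eq)
  have mact: "m \<notin> act x" for x using m by (simp add: active_def)
  have snn: "s x \<ge> 0" if "x \<in> P" for x
    unfolding s_def using that JI by (intro sum_nonneg) (auto simp: halfspace_region_def)
  have s0: "s x = 0 \<longleftrightarrow> J \<subseteq> act x" if "x \<in> P" for x
  proof -
    have "s x = 0 \<longleftrightarrow> (\<forall>j\<in>J. b j - a j \<bullet> x = 0)"
      unfolding s_def using finJ that JI
      by (intro sum_nonneg_eq_0_iff) (auto simp: halfspace_region_def)
    then show ?thesis using JI by (auto simp: active_def)
  qed
  have dir: "\<exists>u. (\<forall>i\<in>act x. a i \<bullet> u = 0) \<and> c \<bullet> u = 1" if x: "x \<in> P" "s x = e" for x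
  proof -
    obtain v where v: "v \<in> P" "act x \<subseteq> act v" "card (act v) = DIM('a)"
      using exists_vertex_above[OF x(1)] by blast
    have "s v \<noteq> e" using eV[of v] v e0 by (auto simp: Vt_def)
    then have nz: "c \<bullet> (v - x) \<noteq> 0" using x(2) by (simp add: s_eq inner_diff_right)
    have "a i \<bullet> (v - x) = 0" if "i \<in> act x" for i
      using that v(2) by (auto simp: active_def inner_diff_right)
    then show ?thesis using nz
      by (intro exI[of _ "(1 / (c \<bullet> (v - x))) *\<^sub>R (v - x)"]) simp
  qed
  have dual': "has_dual_family a' (?act x)" if x: "x \<in> ?P" for x
  proof (cases "s x = e")
    case False
    have "has_dual_family a (act x)" using x P' dual_active by blast
    then show ?thesis using False act' same by (auto simp: has_dual_family_def active_def)
  next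
    case True
    have xP: "x \<in> P" using x P' by blast
    obtain u where u: "\<forall>i\<in>act x. a i \<bullet> u = 0" "c \<bullet> u = 1" using dir[OF xP True] by blast
    have eq: "?act x = insert m (act x)" using True act' by simp
    have sm: "a' i = a i" if "i \<in> act x" for i using that same by (simp add: active_def)
    have am: "a' m = c" by (simp add: a'_def)
    show ?thesis
      unfolding has_dual_family_def eq
    proof
      fix i assume i: "i \<in> insert m (act x)"
      show "\<exists>w. a' i \<bullet> w = 1 \<and> (\<forall>j\<in>insert m (act x) - {i}. a' j \<bullet> w = 0)"
      proof (cases "i = m")
        case True
        then show ?thesis using u sm am by (intro exI[of _ u]) auto
      next
        case False
        then have i': "i \<in> act x" using i by blast
        then obtain w where w: "a i \<bullet> w = 1" "\<forall>j\<in>act x - {i}. a j \<bullet> w = 0"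
          using dual_active[OF xP] unfolding has_dual_family_def by blast
        show ?thesis
          \<comment> \<open>The correction along \<open>u\<close> removes the product with
            \<open>c\<close> and leaves the products with the old active normals unchanged.\<close>
          using w u i' sm am by (intro exI[of _ "w - (c \<bullet> w) *\<^sub>R u"]) (auto simp: inner_diff_right)
      qed
    qed
  qed
  have second: "insert m (A - {j}) \<in> vertex_sets a' b' ?I"
    if A: "A \<in> vertex_sets a b I" "J \<subseteq> A" "j \<in> J" for A j
  proof -
    obtain v where v: "v \<in> P" "A = act v" "card (act v) = DIM('a)"
      using A by (auto simp: vertex_sets_def)
    have jv: "j \<in> act v" using A v by blast
    obtain u where u: "\<forall>k\<in>act v. a k \<bullet> u = (if k = j then -1 else 0)"
      using has_dual_family_prescribe[OF dual_active[OF v(1)] finite_act, of "\<lambda>k. if k = j then -1 else 0"] ..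
    have u': "u \<noteq> 0" "\<And>k. k \<in> act v \<Longrightarrow> a k \<bullet> u \<le> 0"
      using u jv by force+
    \<comment> \<open>Along this edge \<open>s\<close> grows from 0 at unit speed, so the parameter
      \<open>e\<close> gives the point on the cut; the far end is a vertex with
      \<open>s = t > 0\<close>, hence \<open>e < t\<close>.\<close>
    have cu: "c \<bullet> u = -1"
    proof -
      have "c \<bullet> u = (\<Sum>k\<in>J. if k = j then -1 else 0)"
        unfolding c_def inner_sum_left using u A v by (intro sum.cong) auto
      then show ?thesis using A finJ by simp
    qed
    have sv: "s v = 0" using s0 v A by simp
    obtain t k where t: "t > 0" "v + t *\<^sub>R u \<in> P" "k \<in> act (v + t *\<^sub>R u)" "a k \<bullet> u > 0"
      and mid: "\<forall>r. 0 < r \<and> r < t \<longrightarrow>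
         v + r *\<^sub>R u \<in> P \<and> act (v + r *\<^sub>R u) = {i \<in> act v. a i \<bullet> u = 0}"
      by (rule ray_leaves[OF v(1) u'])
    have Aj: "{i \<in> act v. a i \<bullet> u = 0} = A - {j}" using u v by auto
    have kA: "k \<notin> A" using u' t v by force
    have sub: "insert k (A - {j}) \<subseteq> act (v + t *\<^sub>R u)"
      using t(3) u v by (auto simp: active_def inner_right_distrib)
    have finA: "finite A" using v finite_act by simp
    have "card (insert k (A - {j})) = DIM('a)"
      using kA jv v finA card_Suc_Diff1[of A j] by simp
    then have "DIM('a) \<le> card (act (v + t *\<^sub>R u))" using card_mono[OF finite_act sub] by simp
    then have "v + t *\<^sub>R u \<in> Vt"
      using has_dual_family_card_le[OF dual_active[OF t(2)] finite_act] t(2) by (simp add: Vt_def)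
    moreover have "s (v + t *\<^sub>R u) = t" by (simp add: s_line sv cu)
    ultimately have "e < t" using eV t by fastforce
    then have w: "v + e *\<^sub>R u \<in> P" "act (v + e *\<^sub>R u) = A - {j}" using mid e0 Aj by auto
    have "s (v + e *\<^sub>R u) = e" by (simp add: s_line sv cu)
    then have w': "v + e *\<^sub>R u \<in> ?P" "?act (v + e *\<^sub>R u) = insert m (A - {j})"
      using w P' act' by auto
    have "m \<notin> A" using mact v by blast
    then have "card (insert m (A - {j})) = DIM('a)"
      using jv v finA card_Suc_Diff1[of A j] by simp
    then show ?thesis unfolding vertex_sets_def using w' by force
  qed
  have first: "A \<in> vertex_sets a' b' ?I" if A: "A \<in> vertex_sets a b I" "\<not> J \<subseteq> A" for A
  proof -
    obtain v where v: "v \<in> P" "A = act v" "card (act v) = DIM('a)"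
      using A by (auto simp: vertex_sets_def)
    have "s v > 0" using s0[OF v(1)] snn[OF v(1)] A v by force
    then have "s v > e" using eV v by (simp add: Vt_def)
    then have "v \<in> ?P" "?act v = A" using P' act' v by auto
    then show ?thesis unfolding vertex_sets_def using v by force
  qed
  have conv: "A \<in> truncate_sets (vertex_sets a b I) J m" if A: "A \<in> vertex_sets a' b' ?I" for A
  proof -
    obtain x where x: "x \<in> ?P" "A = ?act x" "card (?act x) = DIM('a)"
      using A unfolding vertex_sets_def by blast
    have xP: "x \<in> P" and sx: "s x \<ge> e" using x P' by auto
    have nJ: "\<not> J \<subseteq> act x" using s0[OF xP] sx e0 by simp
    show ?thesis
    proof (cases "s x = e")
      case False
      then have "A = act x" "card (act x) = DIM('a)" using x act' by auto
      then show ?thesis using nJ xP by (auto simp: truncate_sets_def vertex_sets_def)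
    next
      case True
      have Aeq: "A = insert m (act x)" using True act' x by simp
      have cd: "Suc (card (act x)) = DIM('a)"
        using x(3) card_insert_disjoint[OF finite_act[of x] mact[of x]] by (simp flip: x(2) add: Aeq)
      obtain u where u: "\<forall>i\<in>act x. a i \<bullet> u = 0" "c \<bullet> u = 1" using dir[OF xP True] by blast
      then have u': "u \<noteq> 0" "\<And>i. i \<in> act x \<Longrightarrow> a i \<bullet> u \<le> 0" by auto
      obtain t k where t: "t > 0" "x + t *\<^sub>R u \<in> P" "k \<in> act (x + t *\<^sub>R u)" "a k \<bullet> u > 0"
        by (rule ray_leaves[OF xP u'])
      let ?v = "x + t *\<^sub>R u"
      have k: "k \<notin> act x" using u t by auto
      have sub: "insert k (act x) \<subseteq> act ?v"
        using t(3) u by (auto simp: active_def inner_right_distrib)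
      have c1: "card (insert k (act x)) = DIM('a)" using k cd finite_act by simp
      have "card (act ?v) \<le> DIM('a)"
        using has_dual_family_card_le[OF dual_active[OF t(2)] finite_act] .
      then have av: "act ?v = insert k (act x)"
        using card_seteq[OF finite_act sub] c1 by simp
      then have vV: "?v \<in> Vt" using c1 t(2) by (simp add: Vt_def)
      \<comment> \<open>No vertex has \<open>s\<close> strictly between 0 and \<open>e\<close>, so
        this one lies on the face. As \<open>J\<close> was not active at \<open>x\<close>, the
        blocking index \<open>k\<close> belongs to \<open>J\<close>.\<close>
      have "s ?v < e" using t u True by (simp add: s_line)
      then have "s ?v = 0" using eV[OF vV] snn[OF t(2)] by force
      then have Jv: "J \<subseteq> act ?v" using s0[OF t(2)] by simp
      then have kJ: "k \<in> J" using nJ unfolding av by blast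
      have "act ?v \<in> vertex_sets a b I" using vV by (auto simp: Vt_def vertex_sets_def)
      moreover have "A = insert m (act ?v - {k})" using Aeq av k by simp
      ultimately show ?thesis using Jv kJ unfolding truncate_sets_def by blast
    qed
  qed
  have eq: "vertex_sets a' b' ?I = truncate_sets (vertex_sets a b I) J m"
    using first second conv unfolding truncate_sets_def by blast
  obtain j where "j \<in> J" using J0 by blast
  then have "vertex_sets a' b' ?I \<noteq> {}" using second A0 by blast
  then have "?P \<noteq> {}" by (auto simp: vertex_sets_def)
  moreover have "bounded ?P" using bounded_region P'
    by (auto intro: bounded_subset)
  ultimately have "simple_system a' b' ?I" using finite_I dual' by unfold_locales auto
  then show ?thesis using eq by blast
qed

end

text \<open>
  The vertices of the face \<open>J\<close> are those of a simplex whose facets are cut out by the indices in \<open>K\<close>.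
\<close>
definition simplex_face :: "nat set set \<Rightarrow> nat set \<Rightarrow> nat set \<Rightarrow> bool" where
  "simplex_face V J K \<longleftrightarrow> {A\<in>V. J \<subseteq> A} = (\<lambda>i. J \<union> (K - {i})) ` K"

section \<open>Combinatorics of truncated vertex families\<close>

lemma card_truncate_sets:
  assumes "finite V" "finite J" "\<And>A. A \<in> V \<Longrightarrow> m \<notin> A"
  shows "card (truncate_sets V J m) + card {A\<in>V. J \<subseteq> A} = card V + card {A\<in>V. J \<subseteq> A} * card J"
proof -
  let ?F = "{A\<in>V. J \<subseteq> A}" and ?R = "{A\<in>V. \<not> J \<subseteq> A}"
  let ?f = "\<lambda>(A, j). insert m (A - {j})"
  have eq: "truncate_sets V J m = ?R \<union> ?f ` (?F \<times> J)" by (auto simp: truncate_sets_def)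
  \<comment> \<open>Since \<open>J \<subseteq> A\<close>, the relaxed index is recovered as the only
    element of \<open>J\<close> missing from the new set.\<close>
  have "inj_on ?f (?F \<times> J)"
  proof (rule inj_onI, clarify)
    fix A j A' j'
    assume h: "A \<in> V" "J \<subseteq> A" "j \<in> J" "A' \<in> V" "J \<subseteq> A'" "j' \<in> J"
      and eq: "insert m (A - {j}) = insert m (A' - {j'})"
    have eq': "A - {j} = A' - {j'}"
      using eq assms(3)[OF h(1)] assms(3)[OF h(4)] by (metis Diff_iff insert_ident)
    then have "j = j'" using h by blast
    moreover have "A = A'" using h eq' \<open>j = j'\<close> by blast
    ultimately show "A = A' \<and> j = j'" by simp
  qed
  then have "card (?f ` (?F \<times> J)) = card ?F * card J"
    by (simp add: card_image card_cartesian_product)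
  moreover have "?R \<inter> ?f ` (?F \<times> J) = {}" using assms(3) by auto
  ultimately have "card (truncate_sets V J m) = card ?R + card ?F * card J"
    unfolding eq using assms(1,2) by (subst card_Un_disjoint) auto
  moreover have "card V = card ?R + card ?F"
  proof -
    have "V = ?R \<union> ?F" by auto
    then show ?thesis using assms(1) by (metis (no_types, lifting) card_Un_disjoint disjoint_iff finite_Un mem_Collect_eq)
  qed
  ultimately show ?thesis by simp
qed

text \<open>Keeps the system irredundant. For \<open>x\<close> in a face vertex, relaxing some
  \<open>j \<noteq> x\<close> preserves \<open>x\<close>; for \<open>J = {x}\<close> no such
  \<open>j\<close> exists and the index \<open>x\<close> would disappear.\<close>

lemma Union_truncate_sets:
  assumes "J \<subseteq> A0" "A0 \<in> V" "finite J" "card J \<ge> 2"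
  shows "\<Union>(truncate_sets V J m) = insert m (\<Union>V)"
proof -
  have two: "\<exists>j\<in>J. j \<noteq> i" for i
  proof (rule ccontr)
    assume "\<not> ?thesis"
    then have "J \<subseteq> {i}" by blast
    then have "card J \<le> 1" by (metis card.empty card_insert_disjoint card_mono empty_iff finite.emptyI finite.insertI One_nat_def)
    then show False using assms by simp
  qed
  have "x \<in> \<Union>(truncate_sets V J m)" if A: "x \<in> A" "A \<in> V" for x A
  proof (cases "J \<subseteq> A")
    case True
    obtain j where j: "j \<in> J" "j \<noteq> x" using two by blast
    have "insert m (A - {j}) \<in> truncate_sets V J m" using True A j by (auto simp: truncate_sets_def)
    then show ?thesis using A j by blast
  next
    case False
    then have "A \<in> truncate_sets V J m" using A by (simp add: truncate_sets_def)
    then show ?thesis using A by blast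
  qed
  moreover have "m \<in> \<Union>(truncate_sets V J m)"
  proof -
    obtain j where "j \<in> J" using two by blast
    then have "insert m (A0 - {j}) \<in> truncate_sets V J m" using assms by (auto simp: truncate_sets_def)
    then show ?thesis by blast
  qed
  moreover have "\<Union>(truncate_sets V J m) \<subseteq> insert m (\<Union>V)" by (auto simp: truncate_sets_def)
  ultimately show ?thesis by blast
qed

text \<open>Relaxing the same \<open>j0\<close> at all vertices of the face gives a parallel copy of
  the simplex in the new facet. Its tight set has as many elements as \<open>J\<close>, so the
  truncation can be repeated.\<close>

lemma simplex_face_truncate:
  assumes f: "simplex_face V J K" and j0: "j0 \<in> J" and dj: "J \<inter> K = {}"
    and m: "\<And>A. A \<in> V \<Longrightarrow> m \<notin> A"
  shows "simplex_face (truncate_sets V J m) (insert m (J - {j0})) K"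
  unfolding simplex_face_def
proof (intro equalityI subsetI)
  fix B assume "B \<in> {A \<in> truncate_sets V J m. insert m (J - {j0}) \<subseteq> A}"
  then have B: "B \<in> truncate_sets V J m" "m \<in> B" "J - {j0} \<subseteq> B" by auto
  then obtain A j where A: "A \<in> V" "J \<subseteq> A" "j \<in> J" "B = insert m (A - {j})"
    using m unfolding truncate_sets_def by blast
  have "j \<noteq> m" using A m by blast
  then have jj: "j = j0" using A B by blast
  have "A \<in> (\<lambda>i. J \<union> (K - {i})) ` K" using A f unfolding simplex_face_def by blast
  then obtain i where i: "i \<in> K" "A = J \<union> (K - {i})" by blast
  have "B = insert m (J - {j0}) \<union> (K - {i})" using A(4) i jj dj j0 by blast
  then show "B \<in> (\<lambda>i. insert m (J - {j0}) \<union> (K - {i})) ` K" using i by blast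
next
  fix B assume "B \<in> (\<lambda>i. insert m (J - {j0}) \<union> (K - {i})) ` K"
  then obtain i where i: "i \<in> K" "B = insert m (J - {j0}) \<union> (K - {i})" by blast
  let ?A = "J \<union> (K - {i})"
  have A: "?A \<in> V" using f i unfolding simplex_face_def by blast
  have "B = insert m (?A - {j0})" using i dj j0 by blast
  then have "B \<in> truncate_sets V J m" using A j0 unfolding truncate_sets_def by blast
  then show "B \<in> {A \<in> truncate_sets V J m. insert m (J - {j0}) \<subseteq> A}" using i by blast
qed

lemma simplex_face_subface:
  assumes f: "simplex_face V J K" and i: "i \<in> K" "J \<inter> K = {}"
  shows "simplex_face V (insert i J) (K - {i})"
proof -
  have "{A \<in> V. insert i J \<subseteq> A} = {A \<in> (\<lambda>l. J \<union> (K - {l})) ` K. i \<in> A}"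
    using f unfolding simplex_face_def by blast
  also have "\<dots> = (\<lambda>l. insert i J \<union> (K - {i} - {l})) ` (K - {i})"
  proof (intro equalityI subsetI)
    fix A assume "A \<in> {A \<in> (\<lambda>l. J \<union> (K - {l})) ` K. i \<in> A}"
    then obtain l where l: "l \<in> K" "A = J \<union> (K - {l})" "i \<in> A" by blast
    then have "l \<noteq> i" using i by blast
    moreover have "A = insert i J \<union> (K - {i} - {l})" using l i by blast
    ultimately show "A \<in> (\<lambda>l. insert i J \<union> (K - {i} - {l})) ` (K - {i})" using l by blast
  next
    fix A assume "A \<in> (\<lambda>l. insert i J \<union> (K - {i} - {l})) ` (K - {i})"
    then obtain l where l: "l \<in> K" "l \<noteq> i" "A = insert i J \<union> (K - {i} - {l})" by blast
    then have "A = J \<union> (K - {l})" using i by blast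
    then show "A \<in> {A \<in> (\<lambda>l. J \<union> (K - {l})) ` K. i \<in> A}" using l by blast
  qed
  finally show ?thesis unfolding simplex_face_def .
qed

lemma simplex_face_card:
  assumes "simplex_face V J K" "J \<inter> K = {}"
  shows "card {A\<in>V. J \<subseteq> A} = card K"
proof -
  have "inj_on (\<lambda>i. J \<union> (K - {i})) K" using assms(2) by (intro inj_onI) blast
  then show ?thesis using assms(1) unfolding simplex_face_def by (simp add: card_image)
qed

text \<open>The \<open>itself\<close> argument fixes the ambient space and thereby the dimension of
  the polytope; \<open>n\<close> counts vertices. The equation for
  \<open>\<Union>(vertex_sets a b I)\<close> makes every inequality define a facet.\<close>

definition simple_with_simplex_face :: "'a::euclidean_space itself \<Rightarrow> nat \<Rightarrow> nat \<Rightarrow> bool" where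
  "simple_with_simplex_face TYPE('a) n k \<longleftrightarrow>
     (\<exists>(a :: nat \<Rightarrow> 'a) b I J K. simple_system a b I \<and> \<Union>(vertex_sets a b I) = I \<and>
        card (vertex_sets a b I) = n \<and> J \<subseteq> I \<and> K \<subseteq> I \<and> J \<inter> K = {} \<and>
        card K = Suc k \<and> card J + k = DIM('a) \<and> simplex_face (vertex_sets a b I) J K)"

section \<open>Vertex counts reachable by truncation\<close>

lemma simple_with_simplex_face_smaller:
  assumes "simple_with_simplex_face TYPE('a::euclidean_space) n k" "l \<le> k"
  shows "simple_with_simplex_face TYPE('a) n l"
  using assms(2,1)
proof (induction rule: inc_induct)
  case base
  then show ?case .
next
  case (step l)
  from step.IH[OF step.prems] obtain a :: "nat \<Rightarrow> 'a" and b I J K where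
    h: "simple_system a b I" "\<Union>(vertex_sets a b I) = I" "card (vertex_sets a b I) = n"
      "J \<subseteq> I" "K \<subseteq> I" "J \<inter> K = {}" "card K = Suc (Suc l)" "card J + Suc l = DIM('a)"
      "simplex_face (vertex_sets a b I) J K"
    unfolding simple_with_simplex_face_def by blast
  obtain i where i: "i \<in> K" using h(7) by fastforce
  have finI: "finite I" using h(1) by (simp add: simple_system_def)
  have fin: "finite J" "finite K" using finI h finite_subset by blast+
  have "i \<notin> J" using h(6) i by blast
  then have "card (K - {i}) = Suc l" "card (insert i J) + l = DIM('a)"
    using h(7,8) i fin by simp_all
  then show ?case unfolding simple_with_simplex_face_def
    using h i simplex_face_subface[OF h(9) i h(6)]
    by (intro exI[of _ a] exI[of _ b] exI[of _ I] exI[of _ "insert i J"] exI[of _ "K - {i}"]) auto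
qed

text \<open>Each of the \<open>k + 1\<close> vertices of the face is replaced by
  \<open>card J = DIM('a) - k\<close> new ones, a net gain of one less per vertex.\<close>

lemma simple_with_simplex_face_truncate:
  assumes "simple_with_simplex_face TYPE('a::euclidean_space) n k" "k + 2 \<le> DIM('a)"
  shows "simple_with_simplex_face TYPE('a) (n + (k + 1) * (DIM('a) - 1 - k)) k"
proof -
  obtain a :: "nat \<Rightarrow> 'a" and b I J K where
    h: "simple_system a b I" "\<Union>(vertex_sets a b I) = I" "card (vertex_sets a b I) = n"
      "J \<subseteq> I" "K \<subseteq> I" "J \<inter> K = {}" "card K = Suc k" "card J + k = DIM('a)"
      "simplex_face (vertex_sets a b I) J K"
    using assms(1) unfolding simple_with_simplex_face_def by blast
  have finI: "finite I" using h(1) by (simp add: simple_system_def)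
  have finJ: "finite J" using finI h finite_subset by blast
  define V where "V = vertex_sets a b I"
  have finV: "finite V" using simple_system.finite_vertex_sets[OF h(1)] by (simp add: V_def)
  obtain m where m: "m \<notin> I" using finI ex_new_if_finite infinite_UNIV_nat by blast
  have mV: "m \<notin> A" if "A \<in> V" for A using m h(2) that by (auto simp: V_def)
  have J2: "card J \<ge> 2" using h assms(2) by linarith
  have "J \<noteq> {}" using J2 by auto
  then obtain j0 where j0: "j0 \<in> J" by blast
  obtain i where "i \<in> K" using h(7) by fastforce
  then obtain A0 where A0: "A0 \<in> V" "J \<subseteq> A0"
    using h(9) unfolding simplex_face_def V_def by blast
  obtain a' :: "nat \<Rightarrow> 'a" and b' where
    t: "simple_system a' b' (insert m I)" "vertex_sets a' b' (insert m I) = truncate_sets V J m"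
    using simple_system.truncation[OF h(1,4) \<open>J \<noteq> {}\<close> m] A0 unfolding V_def by blast
  have un: "\<Union>(truncate_sets V J m) = insert m I"
    using Union_truncate_sets[OF A0(2,1) finJ J2] h(2) by (simp add: V_def)
  have sf: "simplex_face (truncate_sets V J m) (insert m (J - {j0})) K"
    using simplex_face_truncate[OF _ j0 h(6) mV] h(9) by (simp add: V_def)
  have cJ: "card J = Suc (DIM('a) - 1 - k)" using h(8) assms(2) by linarith
  have cF: "card {A\<in>V. J \<subseteq> A} = k + 1" using simplex_face_card[OF h(9,6)] h(7) by (simp add: V_def)
  have cV: "card V = n" using h(3) by (simp add: V_def)
  have "card (truncate_sets V J m) = n + (k + 1) * (DIM('a) - 1 - k)"
    using card_truncate_sets[OF finV finJ mV] unfolding cF cJ cV mult_Suc_right by linarith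
  moreover have "card (insert m (J - {j0})) + k = DIM('a)"
    using m h(4,8) finJ j0 card_Suc_Diff1[OF finJ j0] by (subst card_insert_disjoint) auto
  moreover have "insert m (J - {j0}) \<inter> K = {}" using h(5,6) m by blast
  ultimately show ?thesis unfolding simple_with_simplex_face_def
    using t un sf h
    by (intro exI[of _ a'] exI[of _ b'] exI[of _ "insert m I"] exI[of _ "insert m (J - {j0})"] exI[of _ K]) auto
qed

lemma simple_with_simplex_face_polytope:
  assumes "simple_with_simplex_face TYPE('a::euclidean_space) n k"
  shows "\<exists>P :: 'a set. simple_polytope DIM('a) P \<and> card (vertices P) = n"
  using assms simple_system.simple_polytope_region simple_system.card_vertices
  unfolding simple_with_simplex_face_def by metis

section \<open>The standard simplex\<close>

lemma has_dual_family_subset: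
  "has_dual_family a B \<Longrightarrow> A \<subseteq> B \<Longrightarrow> has_dual_family a A"
  unfolding has_dual_family_def by (meson Diff_mono subset_iff subset_refl)

lemma simple_with_simplex_face_simplex:
  "simple_with_simplex_face TYPE('a::euclidean_space) (DIM('a) + 1) (DIM('a))"
proof -
  let ?d = "DIM('a)"
  obtain e where e: "bij_betw e {0..<?d} (Basis :: 'a set)"
    using ex_bij_betw_nat_finite[OF finite_Basis] by blast
  have eB: "e i \<in> Basis" if "i < ?d" for i using e that by (auto simp: bij_betw_def)
  have ee: "e i \<bullet> e j = (if i = j then 1 else 0)" if "i < ?d" "j < ?d" for i j
  proof -
    have "e i = e j \<longleftrightarrow> i = j" using e that by (auto simp: bij_betw_def inj_on_def)
    then show ?thesis using eB that by (simp add: inner_Basis)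
  qed
  define a :: "nat \<Rightarrow> 'a" where "a i = (if i < ?d then - e i else One)" for i
  define b :: "nat \<Rightarrow> real" where "b i = (if i < ?d then 0 else 1)" for i
  define I where "I = {..?d}"
  have One_inner: "One \<bullet> x = (\<Sum>j<?d. e j \<bullet> x)" for x :: 'a
    using sum.reindex_bij_betw[OF e, of "\<lambda>v. v \<bullet> x"] by (simp add: inner_sum_left lessThan_atLeast0)
  have One_e: "One \<bullet> e l = 1" if "l < ?d" for l
    using eB[OF that] by simp
  have region: "halfspace_region a b I = {x. (\<forall>i<?d. e i \<bullet> x \<ge> 0) \<and> One \<bullet> x \<le> 1}" (is "?P = _")
  proof -
    have "I = insert ?d {..<?d}" by (auto simp: I_def)
    then show ?thesis by (auto simp: halfspace_region_def a_def b_def)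
  qed
  have "?P \<subseteq> cbox 0 One"
  proof
    fix x assume x: "x \<in> ?P"
    have "0 \<le> v \<bullet> x \<and> v \<bullet> x \<le> 1" if v: "v \<in> Basis" for v
    proof -
      obtain i where i: "i < ?d" "v = e i" using v e by (force simp: bij_betw_def)
      have "e i \<bullet> x \<le> (\<Sum>j<?d. e j \<bullet> x)"
        using x i region by (intro member_le_sum) auto
      then show ?thesis using x i region One_inner[of x] by auto
    qed
    then show "x \<in> cbox 0 One" by (simp add: mem_box inner_commute[of x])
  qed
  then have bdd: "bounded ?P" using bounded_cbox bounded_subset by blast
  have zero: "0 \<in> ?P" by (simp add: region)
  \<comment> \<open>Any \<open>DIM('a)\<close> of the \<open>DIM('a) + 1\<close> normals are
    independent. In the witness \<open>e l - e i\<close> the two terms cancel against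
    \<open>One\<close>, while the normal of \<open>l\<close> itself is left out.\<close>
  have dual: "has_dual_family a (I - {l})" if l: "l \<in> I" for l
    unfolding has_dual_family_def
  proof
    fix i assume i: "i \<in> I - {l}"
    have id: "i \<le> ?d" "i \<noteq> l" using i by (auto simp: I_def)
    show "\<exists>u. a i \<bullet> u = 1 \<and> (\<forall>j\<in>I - {l} - {i}. a j \<bullet> u = 0)"
    proof (cases "l < ?d")
      case False
      then have "l = ?d" "i < ?d" using l id by (auto simp: I_def)
      then show ?thesis
        by (intro exI[of _ "- e i"]) (auto simp: a_def I_def ee)
    next
      case True
      show ?thesis
      proof (cases "i < ?d")
        case False
        then have "i = ?d" using id by simp
        then show ?thesis using True
          by (intro exI[of _ "e l"]) (auto simp: a_def I_def ee One_e)
      next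
        case i: True
        then show ?thesis using True id
          by (intro exI[of _ "e l - e i"]) (auto simp: a_def I_def ee One_e inner_diff_right)
      qed
    qed
  qed
  have miss: "\<exists>l\<in>I. active a b I x \<subseteq> I - {l}" if x: "x \<in> ?P" for x
  proof (rule ccontr)
    assume "\<not> ?thesis"
    then have all: "a i \<bullet> x = b i" if "i \<in> I" for i using that by (auto simp: active_def)
    have "e i \<bullet> x = 0" if "i < ?d" for i using all[of i] that by (simp add: a_def b_def I_def)
    then have "One \<bullet> x = 0" by (simp add: One_inner)
    then show False using all[of ?d] by (simp add: a_def b_def I_def)
  qed
  have sys: "simple_system a b I"
  proof
    show "finite I" by (simp add: I_def)
    show "?P \<noteq> {}" using zero by blast
    show "has_dual_family a (active a b I x)" if "x \<in> ?P" for x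
      using miss[OF that] dual has_dual_family_subset by blast
  qed (rule bdd)
  have cI: "card I = Suc ?d" "finite I" by (simp_all add: I_def)
  have V: "vertex_sets a b I = (\<lambda>l. I - {l}) ` I"
  proof (intro equalityI subsetI)
    fix A assume "A \<in> vertex_sets a b I"
    then obtain x where x: "x \<in> ?P" "A = active a b I x" "card A = ?d"
      by (auto simp: vertex_sets_def)
    then obtain l where l: "l \<in> I" "A \<subseteq> I - {l}" using miss by blast
    have "A = I - {l}" by (rule card_seteq) (use l x cI in auto)
    then show "A \<in> (\<lambda>l. I - {l}) ` I" using l by blast
  next
    fix A assume "A \<in> (\<lambda>l. I - {l}) ` I"
    then obtain l where l: "l \<in> I" "A = I - {l}" by blast
    have "\<exists>x\<in>?P. active a b I x = A"
    proof (cases "l < ?d")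
      case False
      then have "l = ?d" using l by (simp add: I_def)
      then have "active a b I 0 = A" using l by (auto simp: active_def a_def b_def I_def)
      then show ?thesis using zero by blast
    next
      case True
      have "e l \<in> ?P" using True by (auto simp: region ee One_e)
      moreover have "active a b I (e l) = A"
        using l True by (auto simp: active_def a_def b_def I_def ee One_e)
      ultimately show ?thesis by blast
    qed
    moreover have "card A = ?d" using l cI by simp
    ultimately show "A \<in> vertex_sets a b I" unfolding vertex_sets_def by blast
  qed
  have "inj_on (\<lambda>l. I - {l}) I" by (rule inj_onI) blast
  then have cV: "card (vertex_sets a b I) = ?d + 1" using V cI by (simp add: card_image)
  have "\<Union>(vertex_sets a b I) = I"
  proof -
    have "i \<in> \<Union>((\<lambda>l. I - {l}) ` I)" if "i \<in> I" for i
    proof -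
      \<comment> \<open>The dimension is positive, so every \<open>i\<close> survives the removal of
        0 or of 1.\<close>
      have "1 \<in> I" "0 \<in> I" by (simp_all add: I_def Suc_le_eq)
      then show ?thesis using that by (cases "i = 0") force+
    qed
    then show ?thesis unfolding V by blast
  qed
  \<comment> \<open>The whole polytope serves as its own simplex face, with no tight
    inequality.\<close>
  moreover have "simplex_face (vertex_sets a b I) {} I" unfolding simplex_face_def V by auto
  ultimately show ?thesis unfolding simple_with_simplex_face_def
    using sys cV cI by (intro exI[of _ a] exI[of _ b] exI[of _ I] exI[of _ "{}"] exI[of _ I]) auto
qed

section \<open>Greedy decomposition into triangular numbers\<close>

text \<open>
  \<open>pronic_decomp N c k\<close>: there are \<open>k \<ge> k\<^sub>1 \<ge> k\<^sub>2 \<ge> \<dots>\<close> with \<open>N = \<Sum>k\<^sub>i (k\<^sub>i + 1)\<close> and \<open>c = \<Sum>(k\<^sub>i + 1)\<close>. Doubled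
  triangular numbers avoid division.
\<close>
inductive pronic_decomp :: "nat \<Rightarrow> nat \<Rightarrow> nat \<Rightarrow> bool" where
  pronic_decomp_0: "pronic_decomp 0 0 k"
| pronic_decomp_step:
    "pronic_decomp N c l \<Longrightarrow> l \<le> k \<Longrightarrow> pronic_decomp (N + l * (l + 1)) (c + (l + 1)) k"

lemma pronic_decomp_mono: "pronic_decomp N c k \<Longrightarrow> k \<le> k' \<Longrightarrow> pronic_decomp N c k'"
  by (cases rule: pronic_decomp.cases) (auto intro: pronic_decomp.intros[simplified] order_trans)

text \<open>Append a part 0 at the end: it adds nothing to \<open>N\<close>, costs 1 and keeps the
  parts non-increasing. Geometrically this truncates a vertex.\<close>

lemma pronic_decomp_Suc: "pronic_decomp N c k \<Longrightarrow> pronic_decomp N (Suc c) k"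
proof (induction rule: pronic_decomp.induct)
  case (pronic_decomp_0 k)
  show ?case using pronic_decomp_step[OF pronic_decomp.pronic_decomp_0[of 0], of k] by simp
next
  case (pronic_decomp_step N c l k)
  show ?case using pronic_decomp.pronic_decomp_step[OF pronic_decomp_step.IH pronic_decomp_step.hyps(2)] by simp
qed

lemma pronic_decomp_weaken: "c \<le> c' \<Longrightarrow> pronic_decomp N c k \<Longrightarrow> pronic_decomp N c' k"
  by (induction rule: dec_induct) (auto intro: pronic_decomp_Suc)

text \<open>A part \<open>l\<close> stands for truncating an \<open>l\<close>-simplex, which adds
  \<open>(DIM('a) - 1) * (l + 1) - l * (l + 1)\<close> vertices; the last hypothesis is the sum of
  these gains with the subtraction moved across.\<close>

lemma simple_with_simplex_face_pronic_decomp: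
  assumes "pronic_decomp N c k" "simple_with_simplex_face TYPE('a::euclidean_space) n k"
    "k + 2 \<le> DIM('a)" "m + N = n + (DIM('a) - 1) * c"
  shows "simple_with_simplex_face TYPE('a) m 0"
  using assms
proof (induction arbitrary: n rule: pronic_decomp.induct)
  case (pronic_decomp_0 k)
  then show ?case using simple_with_simplex_face_smaller by fastforce
next
  case (pronic_decomp_step N c l k)
  have "simple_with_simplex_face TYPE('a) n l"
    using pronic_decomp_step simple_with_simplex_face_smaller by blast
  then have "simple_with_simplex_face TYPE('a) (n + (l + 1) * (DIM('a) - 1 - l)) l"
    using pronic_decomp_step by (intro simple_with_simplex_face_truncate) auto
  moreover have "l + 2 \<le> DIM('a)" using pronic_decomp_step by linarith
  moreover have "m + N = n + (l + 1) * (DIM('a) - 1 - l) + (DIM('a) - 1) * c"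
  proof -
    define q where "q = DIM('a) - 1 - l"
    have q: "DIM('a) - 1 = q + l" using \<open>l + 2 \<le> DIM('a)\<close> by (simp add: q_def)
    show ?thesis
      using pronic_decomp_step.prems(3) unfolding q by (simp add: algebra_simps)
  qed
  ultimately show ?case by (rule pronic_decomp_step.IH)
qed

text \<open>Splits off the largest triangular number below \<open>R\<close>. When the remainder
  \<open>Q\<close> has reached \<open>t\<close>, the successor of \<open>R\<close> is the next
  triangular number.\<close>

lemma pronic_root:
  fixes R :: nat
  obtains t Q where "2 * R = 2 * Q + t * (t + 1)" "Q \<le> t"
proof -
  have "\<exists>t Q. 2 * R = 2 * Q + t * (t + 1) \<and> Q \<le> t"
  proof (induction R)
    case 0
    show ?case by (intro exI[of _ 0]) simp
  next
    case (Suc R)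
    then obtain t Q where t: "2 * R = 2 * Q + t * (t + 1)" "Q \<le> t" by blast
    show ?case
    proof (cases "Q = t")
      case True
      then show ?thesis using t by (intro exI[of _ "Suc t"] exI[of _ 0]) simp
    next
      case False
      then show ?thesis using t by (intro exI[of _ t] exI[of _ "Suc Q"]) simp
    qed
  qed
  then show thesis using that by blast
qed

text \<open>The finitely many remainders that the general estimate of the greedy cost misses. The
  triangular sums are 1, 1+1, 3, 3+1, 3+1+1 and 6.\<close>

lemma pronic_decomp_small:
  assumes "R \<le> 6"
  shows "\<exists>c\<le>R + 2. pronic_decomp (2 * R) c R"
proof -
  have p0: "pronic_decomp 0 0 k" for k by (rule pronic_decomp_0)
  have p1: "pronic_decomp 2 2 k" if "k \<ge> 1" for k
    using pronic_decomp_step[OF p0, of 1 k] that by (simp add: numeral_eq_Suc)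
  have p2: "pronic_decomp 4 4 k" if "k \<ge> 1" for k
    using pronic_decomp_step[OF p1, of 1 k] that by (simp add: numeral_eq_Suc)
  have p3: "pronic_decomp 6 3 k" if "k \<ge> 2" for k
    using pronic_decomp_step[OF p0, of 2 k] that by (simp add: numeral_eq_Suc)
  have p4: "pronic_decomp 8 5 k" if "k \<ge> 2" for k
    using pronic_decomp_step[OF p1, of 2 k] that by (simp add: numeral_eq_Suc)
  have p5: "pronic_decomp 10 7 k" if "k \<ge> 2" for k
    using pronic_decomp_step[OF p2, of 2 k] that by (simp add: numeral_eq_Suc)
  have p6: "pronic_decomp 12 4 k" if "k \<ge> 3" for k
    using pronic_decomp_step[OF p0, of 3 k] that by (simp add: numeral_eq_Suc)
  have "R \<in> {0,1,2,3,4,5,6}" using assms by auto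
  then show ?thesis
    using p0 p1[of R] p2[of R] p3[of R] p4[of R] p5[of R] p6[of R]
    by (elim insertE) (auto intro: exI[of _ 0] exI[of _ 2] exI[of _ 4] exI[of _ 3] exI[of _ 5] exI[of _ 7])
qed

text \<open>If the remainder \<open>Q\<close> costs at most \<open>t + 2\<close>, the total is at
  most \<open>(t + 2) + (t + 1) = 2 * t + 3\<close>. Induction gives this when
  \<open>2 * t' + 1 \<le> t\<close>; otherwise \<open>t' * (t' + 1) \<le> 2 * t \<le> 4 * t'\<close>
  forces \<open>t' \<le> 3\<close> and \<open>Q \<le> 6\<close>.\<close>

lemma pronic_decomp_greedy:
  "\<exists>t c. t * (t + 1) \<le> 2 * R \<and> c \<le> 2 * t + 3 \<and> pronic_decomp (2 * R) c t"
proof (induction R rule: less_induct)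
  case (less R)
  obtain t Q where t: "2 * R = 2 * Q + t * (t + 1)" "Q \<le> t" by (rule pronic_root)
  show ?case
  proof (cases "t = 0")
    case True
    then show ?thesis using t pronic_decomp_0[of 0] by (intro exI[of _ 0]) auto
  next
    case False
    then have "Q < R" using t by (cases t) auto
    then obtain t' c' where IH: "t' * (t' + 1) \<le> 2 * Q" "c' \<le> 2 * t' + 3" "pronic_decomp (2 * Q) c' t'"
      using less by blast
    have "\<exists>c\<le>t + 2. pronic_decomp (2 * Q) c t"
    proof (cases "2 * t' + 1 \<le> t")
      case True
      then show ?thesis using IH pronic_decomp_mono[OF IH(3), of t] by (intro exI[of _ c']) auto
    next
      case False
      have "t' * (t' + 1) \<le> t' * 4" using IH(1) t(2) False by linarith
      then have "t' \<le> 3" by (cases "t' = 0") simp_all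
      then have "Q \<le> 6" using False t(2) by linarith
      then obtain c where "c \<le> Q + 2" "pronic_decomp (2 * Q) c Q" using pronic_decomp_small by blast
      then show ?thesis using t(2) pronic_decomp_mono[of _ c Q t] by (intro exI[of _ c]) auto
    qed
    then obtain c where c: "c \<le> t + 2" "pronic_decomp (2 * Q) c t" by blast
    have "pronic_decomp (2 * R) (c + (t + 1)) t"
      unfolding t(1) by (rule pronic_decomp_step[OF c(2)]) simp
    then show ?thesis using c(1) t(1) by (intro exI[of _ t] exI[of _ "c + (t + 1)"]) simp
  qed
qed

text \<open>As 2 is invertible modulo the odd \<open>q\<close>, some \<open>T\<close> solves
  \<open>2 * T = - N\<close> modulo \<open>q\<close>: half of whichever of \<open>q - r\<close> and
  \<open>2 * q - r\<close> is even, or 0 if \<open>r = 0\<close>.\<close>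

lemma exists_even_complement:
  fixes q N :: nat
  assumes "odd q"
  obtains T K where "T < q" "N + 2 * T = q * K"
proof -
  define r where "r = N mod q"
  have q0: "q > 0" using assms by (cases q) auto
  have rq: "r < q" using q0 by (simp add: r_def)
  have N: "N = q * (N div q) + r" by (simp add: r_def)
  consider "r = 0" | "r > 0" "odd r" | "r > 0" "even r" by blast
  then show thesis
  proof cases
    case 1
    then show ?thesis using that[of 0 "N div q"] N q0 by simp
  next
    case 2
    then have "even (q - r)" using assms rq by simp
    then have "2 * ((q - r) div 2) = q - r" by simp
    then show ?thesis using that[of "(q - r) div 2" "N div q + 1"] N rq 2 by (simp add: algebra_simps)
  next
    case 3
    then have "2 * ((2 * q - r) div 2) = 2 * q - r" using rq by simp
    then show ?thesis using that[of "(2 * q - r) div 2" "N div q + 2"] N rq 3 by (simp add: algebra_simps)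
  qed
qed

section \<open>Choice of the truncations for a given number of vertices\<close>

theorem theorem5p2:
  fixes d n :: nat
  assumes "d = CARD('n::finite)"
    and "even d" and "d \<ge> 2"
    and "real n > (real d - 1) * (sqrt (2 * real d) + 2 * sqrt (2 * sqrt (2 * real d)) + 5)"
  shows "\<exists>P :: (real ^ 'n) set. simple_polytope d P \<and> card (vertices P) = n"
proof -
  have dim: "DIM(real ^ 'n) = d" using assms(1) by simp
  define S where "S = sqrt (2 * real d)"
  \<comment> \<open>Bounds the cost \<open>(p + 1) + (2 * t + 3)\<close> below, through
    \<open>p \<le> S\<close> and \<open>t \<le> sqrt (2 * S)\<close>.\<close>
  define X where "X = S + 2 * sqrt (2 * S) + 4"
  have S0: "S \<ge> 0" by (simp add: S_def)
  have X4: "X \<ge> 4" using S0 by (simp add: X_def)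
  have n_gt: "real n > (real d - 1) * (X + 1)" using assms(4) by (simp add: X_def S_def algebra_simps)
  \<comment> \<open>A crude bound, only to make the natural subtraction \<open>n - (d + 1)\<close> a
    genuine one.\<close>
  have "(real d - 1) * 5 \<le> (real d - 1) * (X + 1)" using X4 assms(3) by (intro mult_left_mono) auto
  then have "real n > (real d - 1) * 5" using n_gt by (rule le_less_trans)
  then have "real n \<ge> real d + 1" using assms(3) by (simp add: algebra_simps)
  then have nd: "n \<ge> d + 1" by linarith
  have "odd (d - 1)" using assms by simp
  then obtain T K where T: "T < d - 1" and TK: "(n - (d + 1)) + 2 * T = (d - 1) * K"
    by (rule exists_even_complement)
  have "\<exists>k. k + 2 \<le> d \<and> pronic_decomp (2 * T) K k"
  \<comment> \<open>For \<open>T = 0\<close> all \<open>K\<close> parts are zeros. The other case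
    relies on \<open>T \<ge> 1\<close> in the final estimate for \<open>K\<close>.\<close>
  proof (cases "T = 0")
    case True
    have "pronic_decomp (2 * T) K 0"
      using pronic_decomp_weaken[OF le0 pronic_decomp_0] True by simp
    then show ?thesis using assms(3) by (intro exI[of _ 0]) simp
  next
    case False
    \<comment> \<open>The first part is split off before the greedy bound is applied, so the factor
      2 in that bound falls on \<open>t\<close>, of order the square root of \<open>p\<close>, and
      not on \<open>p\<close>.\<close>
    obtain p Q where p: "2 * T = 2 * Q + p * (p + 1)" "Q \<le> p" by (rule pronic_root)
    obtain t c where t: "t * (t + 1) \<le> 2 * Q" "c \<le> 2 * t + 3" "pronic_decomp (2 * Q) c t"
      using pronic_decomp_greedy by blast
    have "p > 0" using p False by (cases p) auto
    have tp: "t \<le> p"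
    proof (rule ccontr)
      assume "\<not> t \<le> p"
      then have "(p + 1) * (p + 2) \<le> t * (t + 1)" by (intro mult_mono) auto
      then show False using t(1) p(2) by (simp add: algebra_simps)
    qed
    have dec: "pronic_decomp (2 * T) (c + (p + 1)) p"
      unfolding p(1) by (rule pronic_decomp_step[OF pronic_decomp_mono[OF t(3) tp]]) simp
    have "p * 2 \<le> p * (p + 1)" using \<open>p > 0\<close> by (intro mult_left_mono) auto
    then have pd: "p + 2 \<le> d" using p(1) T by linarith
    have "p * p \<le> 2 * d" using p(1) T by (simp add: algebra_simps)
    then have "real p ^ 2 \<le> 2 * real d"
      by (metis of_nat_le_iff of_nat_mult of_nat_numeral power2_eq_square)
    then have pS: "real p \<le> S" unfolding S_def by (rule real_le_rsqrt)
    have "t * t \<le> 2 * p" using t(1) p(2) by (simp add: algebra_simps)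
    then have "real t ^ 2 \<le> 2 * real p"
      by (metis of_nat_le_iff of_nat_mult of_nat_numeral power2_eq_square)
    then have "real t \<le> sqrt (2 * S)" using pS by (intro real_le_rsqrt) simp
    then have cost: "real (c + (p + 1)) \<le> X" using pS t(2) unfolding X_def by linarith
    have "real (d - 1) * real K = real n - (real d + 1) + 2 * real T"
      using arg_cong[OF TK, of real] nd by (simp add: of_nat_diff)
    \<comment> \<open>\<open>2 * T \<ge> 2\<close> turns \<open>d + 1\<close> into
      \<open>d - 1\<close>; this loss of one multiple of \<open>d - 1\<close> is why the hypothesis
      has 5 where \<open>X\<close> has 4.\<close>
    then have "(real d - 1) * real K \<ge> real n - (real d - 1)"
      using False assms(3) by (simp add: of_nat_diff)
    then have "(real d - 1) * real K > (real d - 1) * X" using n_gt by (simp add: algebra_simps)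
    then have "real K > X" using assms(3) by (simp add: mult_less_cancel_left)
    then have "c + (p + 1) \<le> K" using cost by linarith
    then show ?thesis using pronic_decomp_weaken dec pd by blast
  qed
  then obtain k where k: "k + 2 \<le> d" "pronic_decomp (2 * T) K k" by blast
  have "simple_with_simplex_face TYPE(real ^ 'n) (d + 1) k"
    using simple_with_simplex_face_smaller[OF simple_with_simplex_face_simplex] k(1) dim
    by (metis add_leD1)
  then have "simple_with_simplex_face TYPE(real ^ 'n) n 0"
    by (rule simple_with_simplex_face_pronic_decomp[OF k(2)]) (use k dim TK nd in auto)
  then show ?thesis using simple_with_simplex_face_polytope dim by metis
qed

end
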